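(* Let $\mathcal{C}(\Gamma_O(\mathbb{S}))$ denote the set of all connected components of $\Gamma_O(\mathbb{S})$, and let $P(\mathrm{Im}(\mathbb{O}))$ denote the set of all one-dimensional subspaces of $\mathrm{Im}(\mathbb{O})$. Then there exists a well-defined bijection $\psi:\mathcal{C}(\Gamma_O(\mathbb{S}))\to P(\mathrm{Im}(\mathbb{O}))$ which acts as follows: if $C\in\mathcal{C}(\Gamma_O(\mathbb{S}))$ and $(a,b)\in C$, then $\psi(C)=\mathbb{R}\,ab$, the line spanned by the octonion product $ab$.
   Context: Cayley-Dickson conventions. Let $\mathcal{M}_0=\mathbb{R}$ with trivial involution, and let $\mathcal{M}_{n+1}=\mathcal{M}_n\times\mathcal{M}_n$ with componentwise real vector space structure, product $(a,b)(c,d)=(ac-\bar d b,\ da+b\bar c)$ and involution $\overline{(a,b)}=(\bar a,-b)$. The octonions are $\mathbb{O}=\mathcal{M}_3$ and the sedenions are $\mathbb{S}=\mathcal{M}_4$, so a sedenion is a pair of octonions. $\mathrm{Im}(\mathbb{O})=\{x\in\mathbb{O}\mid \bar x=-x\}$ is the space of pure octonions. $Z(\mathbb{S})$ denotes the set of zero divisors, i.e. nonzero $u\in\mathbb{S}$ for which there is a nonzero $v\in\mathbb{S}$ with $uv=0$ or $vu=0$ (in $\mathbb{S}$, $uv=0$ if and only if $vu=0$). The orthogonality graph $\Gamma_O(\mathbb{S})$ is the undirected graph whose vertices are the lines $[u]=\mathbb{R}u$, $u\in Z(\mathbb{S})$, in which distinct vertices $[u],[v]$ are adjacent iff $uv=vu=0$.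 A nonzero element $u$ is identified with the vertex $[u]$, so $(a,b)\in C$ means that $[(a,b)]$ is a vertex of $C$. *)

theory Defs
  imports "HOL-Analysis.Analysis" "Graph_Theory.Digraph_Component"
begin

section \<open>Cayley-Dickson algebras\<close>

text \<open>
  One doubling step, for an algebra with product \<open>m\<close> and involution \<open>cj\<close>. The componentwise
  real vector space structure on pairs is the library instance for products.
\<close>

fun cd_cnj :: "('a \<Rightarrow> 'a) \<Rightarrow> 'a \<times> 'a \<Rightarrow> ('a \<times> 'a :: ab_group_add)" where
  "cd_cnj cj (a, b) = (cj a, - b)"

fun cd_mult ::
  "('a \<Rightarrow> 'a \<Rightarrow> 'a) \<Rightarrow> ('a \<Rightarrow> 'a) \<Rightarrow> 'a \<times> 'a \<Rightarrow> 'a \<times> 'a \<Rightarrow> ('a \<times> 'a :: ab_group_add)" where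
  "cd_mult m cj (a, b) (c, d) = (m a c - m (cj d) b, m d a + m b (cj c))"

type_synonym cd1 = "real \<times> real"
type_synonym cd2 = "cd1 \<times> cd1"
type_synonym octonion = "cd2 \<times> cd2"
type_synonym sedenion = "octonion \<times> octonion"

definition cnj1 :: "cd1 \<Rightarrow> cd1" where
  "cnj1 = cd_cnj (\<lambda>x. x)"

definition mult1 :: "cd1 \<Rightarrow> cd1 \<Rightarrow> cd1" where
  "mult1 = cd_mult (*) (\<lambda>x. x)"

definition cnj2 :: "cd2 \<Rightarrow> cd2" where
  "cnj2 = cd_cnj cnj1"

definition mult2 :: "cd2 \<Rightarrow> cd2 \<Rightarrow> cd2" where
  "mult2 = cd_mult mult1 cnj1"

definition oct_cnj :: "octonion \<Rightarrow> octonion" where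
  "oct_cnj = cd_cnj cnj2"

definition oct_mult :: "octonion \<Rightarrow> octonion \<Rightarrow> octonion" where
  "oct_mult = cd_mult mult2 cnj2"

definition sed_mult :: "sedenion \<Rightarrow> sedenion \<Rightarrow> sedenion" where
  "sed_mult = cd_mult oct_mult oct_cnj"

definition Im_oct :: "octonion set" where
  "Im_oct = {x. oct_cnj x = - x}"

definition proj_Im_oct :: "octonion set set" where
  "proj_Im_oct = {L. subspace L \<and> L \<subseteq> Im_oct \<and> dim L = 1}"


section \<open>The orthogonality graph of the sedenions\<close>

definition zero_divisors :: "sedenion set" where
  "zero_divisors = {u. u \<noteq> 0 \<and> (\<exists>v. v \<noteq> 0 \<and> (sed_mult u v = 0 \<or> sed_mult v u = 0))}"

text \<open>
  The undirected graph is represented by the symmetric digraph containing both orientations of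
  every edge; the vertex \<open>[u]\<close> is the line \<open>span {u}\<close>.
\<close>

definition orth_graph :: "sedenion set pair_pre_digraph" where
  "orth_graph =
    \<lparr> pverts = {span {u} |u. u \<in> zero_divisors},
      parcs = {(span {u}, span {v}) |u v. u \<in> zero_divisors \<and> v \<in> zero_divisors \<and>
                 span {u} \<noteq> span {v} \<and> sed_mult u v = 0 \<and> sed_mult v u = 0} \<rparr>"

lemma sym_digraph_orth_graph: "sym_digraph (with_proj orth_graph)"
proof
  show "tail (with_proj orth_graph) e \<in> verts (with_proj orth_graph)"
    "head (with_proj orth_graph) e \<in> verts (with_proj orth_graph)"
    if "e \<in> arcs (with_proj orth_graph)" for e
    using that by (auto simp: orth_graph_def)
  have "sym (parcs orth_graph)"
    unfolding orth_graph_def by (rule symI) (simp only: pair_pre_digraph.simps, blast)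
  then show "Digraph.symmetric (with_proj orth_graph)"
    by (simp add: Digraph.symmetric_def)
qed

text \<open>
  The connected components, as induced subgraphs. In a symmetric digraph the strongly connected
  components are the connected components of the underlying undirected graph.
\<close>

definition orth_components :: "(sedenion set, sedenion set \<times> sedenion set) pre_digraph set" where
  "orth_components = pre_digraph.sccs (with_proj orth_graph)"

end

theory Submission
  imports Defs
begin

text \<open>
  The octonions form a composition algebra: multiplication by the conjugate of \<open>x\<close> is adjoint to
  multiplication by \<open>x\<close>, and the polarised alternative laws hold. These identities suffice for a
  coordinate-free argument. Below, \<open>x\<^sup>*\<close> denotes the conjugate of \<open>x\<close>.

  If \<open>(a, b)\<close> and \<open>(c, d)\<close> are nonzero sedenions with product zero, testing the two equations
  \<open>ac = d\<^sup>*b\<close> and \<open>da = - bc\<^sup>*\<close> against suitable vectors forces \<open>a\<close> and \<open>b\<close> to be pure,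
  orthogonal and of equal norm, and likewise \<open>c\<close> and \<open>d\<close>. Moreover \<open>c\<close> is orthogonal to \<open>ab\<close>,
  and \<open>d = - (ab)c / |a|\<^sup>2\<close>, called the companion of \<open>c\<close> below; conversely each nonzero pure \<open>c\<close>
  orthogonal to \<open>a\<close>, \<open>b\<close> and \<open>ab\<close> gives, with its companion, a neighbour of \<open>(a, b)\<close>
  (lemmas \<open>annihilator_eq_companion\<close> and \<open>companion_annihilates\<close>). As \<open>c\<close> and \<open>ab\<close> anticommute,
  \<open>cd\<close> is a negative multiple of \<open>ab\<close>. Hence the line \<open>\<real> ab\<close> is constant along walks, while each
  edge reverses the direction of the product on that line.

  For the converse, suppose that \<open>a'b'\<close> is a positive multiple of \<open>ab\<close>. A nonzero \<open>c\<close> orthogonal to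
  \<open>1\<close>, \<open>a\<close>, \<open>b\<close>, \<open>ab\<close>, \<open>a'\<close> and \<open>b'\<close> exists, since these are six linear conditions in
  dimension eight, and its companion is the same for both pairs, so \<open>(c, d)\<close> is a common
  neighbour. If the factor is negative, one further edge changes its sign. Thus two vertices with the
  same product line are connected (lemma \<open>reachable_if_same_line\<close>). Finally every pure line
  \<open>\<real> n\<close> is a product line: take a nonzero pure \<open>a\<close> orthogonal to \<open>n\<close> and let \<open>b\<close> be a multiple
  of \<open>an\<close>.
\<close>

section \<open>The octonions as a composition algebra\<close>

notation oct_mult (infixl "\<star>" 70)

definition oct_one :: octonion where
  "oct_one = (((1, 0), 0), 0)"

lemmas oct_coords = oct_mult_def oct_cnj_def mult2_def cnj2_def mult1_def cnj1_def

lemma bounded_bilinear_oct_mult: "bounded_bilinear (\<star>)"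
  unfolding bilinear_conv_bounded_bilinear[symmetric] bilinear_def
  by (auto intro!: linearI simp: oct_coords algebra_simps)

interpretation oct: bounded_bilinear "(\<star>)"
  by (rule bounded_bilinear_oct_mult)

lemma oct_cnj_minus [simp]: "oct_cnj (- x) = - oct_cnj x"
  by (cases x) (auto simp: oct_coords)

lemma oct_cnj_cnj [simp]: "oct_cnj (oct_cnj x) = x"
  by (cases x) (auto simp: oct_coords)

lemma oct_cnj_zero_iff [simp]: "oct_cnj x = 0 \<longleftrightarrow> x = 0"
  by (cases x) (auto simp: oct_coords zero_prod_def)

lemma oct_one_left [simp]: "oct_one \<star> x = x"
  by (cases x) (auto simp: oct_coords oct_one_def zero_prod_def)

lemma oct_one_right [simp]: "x \<star> oct_one = x"
  by (cases x) (auto simp: oct_coords oct_one_def zero_prod_def)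

lemma oct_cnj_mult: "oct_cnj (x \<star> y) = oct_cnj y \<star> oct_cnj x"
  by (cases x; cases y) (auto simp: oct_coords algebra_simps)

lemma inner_mult_left_adjoint: "inner (x \<star> y) z = inner y (oct_cnj x \<star> z)"
  by (cases x; cases y; cases z) (auto simp: oct_coords algebra_simps)

lemma inner_mult_right_adjoint: "inner (x \<star> y) z = inner x (z \<star> oct_cnj y)"
  by (cases x; cases y; cases z) (auto simp: oct_coords algebra_simps)

text \<open>
  The alternative laws, polarised in the repeated factor: this is the form in which they show that
  orthogonal pure octonions anticommute as multiplication operators.
\<close>

lemma left_alternative_polarised:
  "oct_cnj x \<star> (y \<star> z) + oct_cnj y \<star> (x \<star> z) = (2 * inner x y) *\<^sub>R z"
  by (cases x; cases y; cases z) (auto simp: oct_coords algebra_simps)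

lemma right_alternative_polarised:
  "(z \<star> x) \<star> oct_cnj y + (z \<star> y) \<star> oct_cnj x = (2 * inner x y) *\<^sub>R z"
  by (cases x; cases y; cases z) (auto simp: oct_coords algebra_simps)

lemma cnj_mult_cancel_left: "oct_cnj x \<star> (x \<star> z) = (norm x)\<^sup>2 *\<^sub>R z"
proof -
  have "2 *\<^sub>R (oct_cnj x \<star> (x \<star> z)) = 2 *\<^sub>R ((norm x)\<^sup>2 *\<^sub>R z)"
    using left_alternative_polarised[of x x z]
    by (simp only: scaleR_2 scaleR_scaleR[symmetric] power2_norm_eq_inner)
  then show ?thesis by (simp only: scaleR_cancel_left) simp
qed

lemma cnj_mult_cancel_right: "(z \<star> x) \<star> oct_cnj x = (norm x)\<^sup>2 *\<^sub>R z"
proof -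
  have "2 *\<^sub>R ((z \<star> x) \<star> oct_cnj x) = 2 *\<^sub>R ((norm x)\<^sup>2 *\<^sub>R z)"
    using right_alternative_polarised[of z x x]
    by (simp only: scaleR_2 scaleR_scaleR[symmetric] power2_norm_eq_inner)
  then show ?thesis by (simp only: scaleR_cancel_left) simp
qed

lemma inner_mult_same_left: "inner (x \<star> y) (x \<star> z) = (norm x)\<^sup>2 * inner y z"
  by (simp add: inner_mult_left_adjoint cnj_mult_cancel_left)

lemma inner_mult_same_right: "inner (y \<star> x) (z \<star> x) = (norm x)\<^sup>2 * inner y z"
  by (simp add: inner_mult_right_adjoint cnj_mult_cancel_right)

lemma inner_mult_left_factor: "inner (x \<star> y) x = (norm x)\<^sup>2 * inner y oct_one"
  using inner_mult_same_left[of x y oct_one] by simp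

lemma inner_mult_right_factor: "inner (y \<star> x) x = (norm x)\<^sup>2 * inner y oct_one"
  using inner_mult_same_right[of y x oct_one] by simp

lemma norm_oct_mult: "norm (x \<star> y) = norm x * norm y"
proof -
  have "(norm (x \<star> y))\<^sup>2 = (norm x * norm y)\<^sup>2"
    using inner_mult_same_left[of x y y]
    by (simp add: power2_norm_eq_inner[symmetric] power_mult_distrib)
  then show ?thesis by simp
qed

lemma norm_oct_cnj [simp]: "norm (oct_cnj x) = norm x"
  by (cases x) (auto simp: oct_coords norm_eq_sqrt_inner)


section \<open>Pure octonions\<close>

lemma Im_oct_iff: "x \<in> Im_oct \<longleftrightarrow> inner x oct_one = 0"
  by (cases x) (auto simp: Im_oct_def oct_coords oct_one_def)

lemma oct_cnj_Im: "x \<in> Im_oct \<Longrightarrow> oct_cnj x = - x"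
  by (simp add: Im_oct_def)

lemma subspace_Im_oct: "subspace Im_oct"
  by (auto simp: subspace_def Im_oct_iff inner_add_left)

lemma Im_mult_cancel_left: "x \<in> Im_oct \<Longrightarrow> x \<star> (x \<star> z) = - ((norm x)\<^sup>2 *\<^sub>R z)"
  using cnj_mult_cancel_left[of x z]
  by (simp add: oct_cnj_Im oct.minus_left neg_eq_iff_add_eq_0 eq_neg_iff_add_eq_0 add.commute)

lemma Im_mult_cancel_right: "x \<in> Im_oct \<Longrightarrow> (z \<star> x) \<star> x = - ((norm x)\<^sup>2 *\<^sub>R z)"
  using cnj_mult_cancel_right[of z x]
  by (simp add: oct_cnj_Im oct.minus_right neg_eq_iff_add_eq_0 eq_neg_iff_add_eq_0 add.commute)

lemma Im_right_anticommute:
  assumes "x \<in> Im_oct" "y \<in> Im_oct" "inner x y = 0"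
  shows "(z \<star> x) \<star> y = - ((z \<star> y) \<star> x)"
  using right_alternative_polarised[of z x y] assms
  by (simp add: oct_cnj_Im oct.minus_right neg_eq_iff_add_eq_0 eq_neg_iff_add_eq_0 add.commute)

lemma Im_anticommute:
  assumes "x \<in> Im_oct" "y \<in> Im_oct" "inner x y = 0"
  shows "x \<star> y = - (y \<star> x)"
  using Im_right_anticommute[OF assms, of oct_one] by simp

lemma Im_mult_orthogonal:
  assumes "x \<in> Im_oct" "y \<in> Im_oct" "inner x y = 0"
  shows "x \<star> y \<in> Im_oct"
  using Im_anticommute[OF assms] assms
  by (simp add: Im_oct_def oct_cnj_mult oct.minus_left oct.minus_right)

lemma inner_Im_mult_one: "x \<in> Im_oct \<Longrightarrow> inner (x \<star> y) oct_one = - inner x y"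
  by (simp add: inner_mult_left_adjoint oct_cnj_Im) (simp add: inner_commute)

lemma Im_mult_swap:
  assumes "x \<in> Im_oct" "y \<in> Im_oct" "z \<in> Im_oct" "w \<in> Im_oct" "x \<star> y = z \<star> w"
  shows "y \<star> x = w \<star> z"
proof -
  have "oct_cnj (x \<star> y) = oct_cnj (z \<star> w)" using assms by simp
  then show ?thesis using assms(1-4)
    by (simp add: oct_cnj_mult oct_cnj_Im oct.minus_left oct.minus_right)
qed


section \<open>Zero divisors of the sedenions\<close>

lemma sed_mult_pair:
  "sed_mult (a, b) (c, d) = (a \<star> c - oct_cnj d \<star> b, d \<star> a + b \<star> oct_cnj c)"
  by (simp add: sed_mult_def)

lemma pair_eq_zero_iff: "(a, b) = (0 :: sedenion) \<longleftrightarrow> a = 0 \<and> b = 0"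
  by (simp add: prod_eq_iff)

lemma sed_mult_zero_iff:
  "sed_mult (a, b) (c, d) = 0 \<longleftrightarrow> a \<star> c = oct_cnj d \<star> b \<and> d \<star> a = - (b \<star> oct_cnj c)"
  by (simp add: sed_mult_pair pair_eq_zero_iff eq_neg_iff_add_eq_0)

text \<open>
  The conjugation of the sedenions reverses products, so it exchanges the roles of the two factors.
\<close>

lemma sed_mult_zero_cnj:
  assumes "sed_mult (a, b) (c, d) = 0"
  shows "sed_mult (oct_cnj c, - d) (oct_cnj a, - b) = 0"
proof -
  have 1: "a \<star> c = oct_cnj d \<star> b" and 2: "d \<star> a = - (b \<star> oct_cnj c)"
    using assms by (auto simp: sed_mult_zero_iff)
  have "oct_cnj (a \<star> c) = oct_cnj (oct_cnj d \<star> b)" using 1 by simp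
  then show ?thesis using 2
    by (simp add: sed_mult_zero_iff oct_cnj_mult oct.minus_left oct.minus_right)
qed

definition orthogonal_pure_pair :: "octonion \<Rightarrow> octonion \<Rightarrow> bool" where
  "orthogonal_pure_pair a b \<longleftrightarrow>
     a \<in> Im_oct \<and> b \<in> Im_oct \<and> inner a b = 0 \<and> norm a = norm b \<and> a \<noteq> 0"

lemma nonzero_pair_norms: "(c, d) \<noteq> (0 :: sedenion) \<Longrightarrow> (norm c)\<^sup>2 + (norm d)\<^sup>2 > 0"
  by (auto simp: pair_eq_zero_iff sum_power2_gt_zero_iff)

text \<open>
  The real part of \<open>a\<close> is computed once from each of the two equations, multiplied by \<open>|c|\<^sup>2\<close> and by
  \<open>|d|\<^sup>2\<close>. Both computations produce the same trilinear term, with opposite signs, so adding them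
  leaves \<open>|c|\<^sup>2 + |d|\<^sup>2\<close> times the real part equal to zero; similarly for \<open>b\<close>.
\<close>

lemma annihilating_left_pure:
  assumes zero: "sed_mult (a, b) (c, d) = 0" and nz: "(c, d) \<noteq> 0"
  shows "a \<in> Im_oct" "b \<in> Im_oct"
proof -
  have 1: "a \<star> c = oct_cnj d \<star> b" and 2: "d \<star> a = - (b \<star> oct_cnj c)"
    using zero by (auto simp: sed_mult_zero_iff)
  note pos = nonzero_pair_norms[OF nz]
  have "(norm c)\<^sup>2 * inner a oct_one = inner b (d \<star> c)"
    using inner_mult_right_factor[of a c] 1 by (simp add: inner_mult_left_adjoint)
  moreover have "(norm d)\<^sup>2 * inner a oct_one = - inner b (d \<star> c)"
    using inner_mult_left_factor[of d a] 2 by (simp add: inner_mult_right_adjoint)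
  ultimately have "((norm c)\<^sup>2 + (norm d)\<^sup>2) * inner a oct_one = 0"
    by (simp add: algebra_simps)
  then show "a \<in> Im_oct" using pos by (auto simp: Im_oct_iff)
  have "(norm d)\<^sup>2 * inner b oct_one = inner (a \<star> c) (oct_cnj d)"
    using inner_mult_left_factor[of "oct_cnj d" b] 1 by simp
  also have "\<dots> = inner a (oct_cnj d \<star> oct_cnj c)" by (rule inner_mult_right_adjoint)
  finally have 3: "(norm d)\<^sup>2 * inner b oct_one = inner a (oct_cnj d \<star> oct_cnj c)" .
  have "(norm c)\<^sup>2 * inner b oct_one = - inner (d \<star> a) (oct_cnj c)"
    using inner_mult_right_factor[of b "oct_cnj c"] 2 by simp
  also have "\<dots> = - inner a (oct_cnj d \<star> oct_cnj c)" by (simp add: inner_mult_left_adjoint)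
  finally have "((norm c)\<^sup>2 + (norm d)\<^sup>2) * inner b oct_one = 0"
    using 3 by (simp add: algebra_simps)
  then show "b \<in> Im_oct" using pos by (auto simp: Im_oct_iff)
qed

lemma annihilating_pure:
  assumes "sed_mult (a, b) (c, d) = 0" "(a, b) \<noteq> 0" "(c, d) \<noteq> 0"
  shows "a \<in> Im_oct" "b \<in> Im_oct" "c \<in> Im_oct" "d \<in> Im_oct"
proof -
  show "a \<in> Im_oct" "b \<in> Im_oct" using annihilating_left_pure assms by blast+
  have "(oct_cnj a, - b) \<noteq> 0" using assms(2) by (auto simp: pair_eq_zero_iff)
  note annihilating_left_pure[OF sed_mult_zero_cnj[OF assms(1)] this]
  then have c: "c = - oct_cnj c" and d: "- d \<in> Im_oct"
    by (simp_all add: Im_oct_def)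
  show "c \<in> Im_oct" using arg_cong[OF c, of uminus] by (simp add: Im_oct_def)
  show "d \<in> Im_oct" using subspace_neg[OF subspace_Im_oct d] by simp
qed

lemma sed_mult_zero_pure:
  assumes "c \<in> Im_oct" "d \<in> Im_oct"
  shows "sed_mult (a, b) (c, d) = 0 \<longleftrightarrow> a \<star> c = - (d \<star> b) \<and> d \<star> a = b \<star> c"
  using assms by (simp add: sed_mult_zero_iff oct_cnj_Im oct.minus_left oct.minus_right)

lemma sed_mult_zero_commute:
  assumes "a \<in> Im_oct" "b \<in> Im_oct" "c \<in> Im_oct" "d \<in> Im_oct"
    and "sed_mult (a, b) (c, d) = 0"
  shows "sed_mult (c, d) (a, b) = 0"
proof -
  have 1: "a \<star> c = - d \<star> b" and 2: "d \<star> a = b \<star> c"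
    using assms sed_mult_zero_pure by (auto simp: oct.minus_left)
  have "- d \<in> Im_oct" using assms subspace_neg[OF subspace_Im_oct] by blast
  then have "c \<star> a = b \<star> - d" using Im_mult_swap 1 assms by blast
  then show ?thesis using 2 assms by (simp add: sed_mult_zero_pure oct.minus_right)
qed

lemma annihilating_orthogonal:
  assumes zero: "sed_mult (a, b) (c, d) = 0" and nz: "(a, b) \<noteq> 0" "(c, d) \<noteq> 0"
  shows "orthogonal_pure_pair a b"
proof -
  note pure = annihilating_pure[OF assms]
  have 1: "a \<star> c = - (d \<star> b)" and 2: "d \<star> a = b \<star> c"
    using zero pure sed_mult_zero_pure by auto
  note pos = nonzero_pair_norms[OF nz(2)]
  have "(norm c)\<^sup>2 * inner a b = inner (a \<star> c) (b \<star> c)" by (simp add: inner_mult_same_right)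
  also have "\<dots> = - inner (d \<star> b) (d \<star> a)" using 1 2 by simp
  also have "\<dots> = - ((norm d)\<^sup>2 * inner a b)"
    by (simp add: inner_mult_same_left inner_commute)
  finally have "((norm c)\<^sup>2 + (norm d)\<^sup>2) * inner a b = 0" by (simp add: algebra_simps)
  then have orth: "inner a b = 0" using pos by auto
  have "norm a * norm c = norm d * norm b" "norm d * norm a = norm b * norm c"
    using 1 2 by (metis norm_oct_mult norm_minus_cancel)+
  then have "(norm a * norm c)\<^sup>2 + (norm d * norm a)\<^sup>2 = (norm d * norm b)\<^sup>2 + (norm b * norm c)\<^sup>2"
    by simp
  then have "((norm c)\<^sup>2 + (norm d)\<^sup>2) * (norm a)\<^sup>2 = ((norm c)\<^sup>2 + (norm d)\<^sup>2) * (norm b)\<^sup>2"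
    by (simp add: algebra_simps power_mult_distrib)
  then have "norm a = norm b" using pos by auto
  then show ?thesis using pure orth nz(1) by (auto simp: orthogonal_pure_pair_def pair_eq_zero_iff)
qed

lemma annihilating_orthogonal_pure_pairs:
  assumes "sed_mult (a, b) (c, d) = 0" "(a, b) \<noteq> 0" "(c, d) \<noteq> 0"
  shows "orthogonal_pure_pair a b" "orthogonal_pure_pair c d"
proof -
  show "orthogonal_pure_pair a b" using annihilating_orthogonal[OF assms] .
  have "sed_mult (c, d) (a, b) = 0"
    using sed_mult_zero_commute annihilating_pure[OF assms] assms(1) by blast
  from annihilating_orthogonal[OF this assms(3,2)] show "orthogonal_pure_pair c d" .
qed


section \<open>Annihilators\<close>

text \<open>
  The second component that \<open>c\<close> must carry in order to annihilate \<open>(a, b)\<close>: solving \<open>da = bc\<close> for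
  \<open>d\<close> gives \<open>- (bc)a / |a|\<^sup>2\<close>, and moving \<open>a\<close> inwards turns \<open>(bc)a\<close> into \<open>(ab)c\<close>.
\<close>

definition companion :: "octonion \<Rightarrow> octonion \<Rightarrow> octonion \<Rightarrow> octonion" where
  "companion a b c = - ((1 / (norm a)\<^sup>2) *\<^sub>R ((a \<star> b) \<star> c))"

text \<open>
  Testing \<open>da = bc\<close> against \<open>ba\<close> shows that the inner product of \<open>a\<close> and \<open>c\<close> equals that of \<open>d\<close>
  and \<open>b\<close>, while the real parts of \<open>ac = - db\<close> give the same relation with the opposite sign; hence
  both vanish. Orthogonal pure octonions anticommute as right multiplications, so that
  \<open>da = bc\<close> can be solved for \<open>d\<close> in terms of \<open>(ab)c\<close>.
\<close>

lemma annihilator_eq_companion: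
  assumes zero: "sed_mult (a, b) (c, d) = 0"
    and ab: "orthogonal_pure_pair a b" and cd: "orthogonal_pure_pair c d"
  shows "inner c (a \<star> b) = 0" "d = companion a b c"
proof -
  have pure: "a \<in> Im_oct" "b \<in> Im_oct" "c \<in> Im_oct" "d \<in> Im_oct"
    and norms: "norm b = norm a" "a \<noteq> 0" and orth: "inner a b = 0"
    using ab cd by (auto simp: orthogonal_pure_pair_def)
  have 1: "a \<star> c = - (d \<star> b)" and 2: "d \<star> a = b \<star> c"
    using zero pure sed_mult_zero_pure by auto
  have "(norm a)\<^sup>2 * inner a c = (norm a)\<^sup>2 * inner d b"
    using inner_mult_same_left[of b c a] inner_mult_same_right[of d a b] 2 norms
    by (simp add: inner_commute)
  moreover have "inner a c = - inner d b"
    using inner_Im_mult_one[OF pure(1), of c] inner_Im_mult_one[OF pure(4), of b] 1 by simp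
  ultimately have ac: "inner a c = 0" using norms by simp
  have "c \<star> b = a \<star> d" using Im_mult_swap[OF pure(4,1,2,3) 2] by simp
  then have "inner (a \<star> b) c = - inner (a \<star> d) a"
    using pure inner_commute[of a]
    by (simp add: inner_mult_right_adjoint[of a b] oct_cnj_Im oct.minus_right)
  also have "\<dots> = 0"
    using pure by (simp add: inner_mult_left_factor Im_oct_iff)
  finally show "inner c (a \<star> b) = 0" by (simp add: inner_commute)
  have "(norm a)\<^sup>2 *\<^sub>R d = - ((b \<star> c) \<star> a)"
    using Im_mult_cancel_right[OF pure(1), of d] 2 by simp
  also have "\<dots> = (b \<star> a) \<star> c"
    using Im_right_anticommute[OF pure(3,1), of b] ac by (simp add: inner_commute)
  also have "\<dots> = - ((a \<star> b) \<star> c)"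
    using Im_anticommute[OF pure(1,2) orth] by (simp add: oct.minus_left)
  finally have "(1 / (norm a)\<^sup>2) *\<^sub>R ((norm a)\<^sup>2 *\<^sub>R d) = companion a b c"
    unfolding companion_def by simp
  then show "d = companion a b c" using norms by simp
qed

text \<open>
  The sign here is the crux: an edge maps the direction of \<open>ab\<close> to its opposite on the same line.
\<close>

lemma mult_companion:
  assumes "orthogonal_pure_pair a b" "c \<in> Im_oct" "inner c (a \<star> b) = 0"
  shows "c \<star> companion a b c = - ((norm c)\<^sup>2 / (norm a)\<^sup>2) *\<^sub>R (a \<star> b)"
proof -
  have "a \<star> b \<in> Im_oct" using assms Im_mult_orthogonal unfolding orthogonal_pure_pair_def by blast
  then have "(a \<star> b) \<star> c = - (c \<star> (a \<star> b))"
    using assms Im_anticommute[of "a \<star> b" c] by (simp add: inner_commute)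
  then show ?thesis using assms
    by (simp add: companion_def oct.minus_right oct.scaleR_right Im_mult_cancel_left)
qed

text \<open>
  For pairwise orthogonal pure octonions the product \<open>(ab)c\<close> is invariant under cyclic
  permutation. Written with \<open>a\<close> or \<open>b\<close> as the last factor, a further multiplication by that factor
  cancels, and both equations result.
\<close>

lemma companion_annihilates:
  assumes ab: "orthogonal_pure_pair a b" and c: "c \<in> Im_oct"
    and orth: "inner c a = 0" "inner c b = 0" "inner c (a \<star> b) = 0"
  shows "sed_mult (a, b) (c, companion a b c) = 0" "sed_mult (c, companion a b c) (a, b) = 0"
proof -
  have pure: "a \<in> Im_oct" "b \<in> Im_oct" and norms: "norm b = norm a" "a \<noteq> 0"
    and oab: "inner a b = 0"
    using ab by (auto simp: orthogonal_pure_pair_def)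
  define p where "p = (a \<star> b) \<star> c"
  have p1: "p = (b \<star> c) \<star> a"
    using Im_anticommute[OF pure oab] Im_right_anticommute[OF pure(1) c, of b] orth
    by (simp add: p_def oct.minus_left inner_commute)
  also have "\<dots> = - ((c \<star> b) \<star> a)"
    using Im_anticommute[OF pure(2) c] orth by (simp add: oct.minus_left inner_commute)
  also have "\<dots> = (c \<star> a) \<star> b"
    using Im_right_anticommute[OF pure oab, of c] by simp
  finally have p2: "p = (c \<star> a) \<star> b" .
  have d: "companion a b c = - ((1 / (norm a)\<^sup>2) *\<^sub>R p)" by (simp add: companion_def p_def)
  have "a \<star> b \<in> Im_oct" using Im_mult_orthogonal pure oab by blast
  then have "p \<in> Im_oct"
    unfolding p_def using Im_mult_orthogonal[of "a \<star> b" c] c orth by (simp add: inner_commute)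
  then have dpure: "companion a b c \<in> Im_oct"
    using d subspace_Im_oct by (simp add: subspace_neg subspace_mul)
  have "companion a b c \<star> a = b \<star> c"
    using norms pure
    by (simp add: d p1 oct.minus_left oct.scaleR_left Im_mult_cancel_right)
  moreover have "companion a b c \<star> b = c \<star> a"
    using norms pure
    by (simp add: d p2 oct.minus_left oct.scaleR_left Im_mult_cancel_right)
  ultimately show zero: "sed_mult (a, b) (c, companion a b c) = 0"
    using Im_anticommute[OF pure(1) c] orth c dpure
    by (simp add: sed_mult_zero_pure inner_commute)
  show "sed_mult (c, companion a b c) (a, b) = 0"
    using sed_mult_zero_commute[OF pure c dpure zero] .
qed

text \<open>
  Purity is one more linear condition, orthogonality to \<open>1\<close>, so up to six further vectors leave room
  in dimension eight.
\<close>

lemma exists_common_orthogonal: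
  fixes xs :: "octonion list"
  assumes "length xs \<le> 6"
  obtains c where "c \<noteq> 0" "c \<in> Im_oct" "\<And>x. x \<in> set xs \<Longrightarrow> inner c x = 0"
proof -
  have "dim (set (oct_one # xs)) \<le> card (set (oct_one # xs))" by (rule dim_le_card') simp
  also have "\<dots> \<le> length (oct_one # xs)" by (rule card_length)
  finally have "dim (set (oct_one # xs)) < DIM(octonion)" using assms by simp
  from orthogonal_to_subspace_exists[OF this] obtain c
    where "c \<noteq> 0" "\<And>y. y \<in> span (set (oct_one # xs)) \<Longrightarrow> orthogonal c y" by blast
  then have "c \<noteq> 0" "\<And>y. y \<in> set (oct_one # xs) \<Longrightarrow> inner c y = 0"
    using span_base unfolding orthogonal_def by blast+
  then show thesis using that by (simp add: Im_oct_iff)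
qed

lemma zero_divisors_iff: "(a, b) \<in> zero_divisors \<longleftrightarrow> orthogonal_pure_pair a b"
proof
  assume "(a, b) \<in> zero_divisors"
  then obtain v where "(a, b) \<noteq> 0" "v \<noteq> 0" "sed_mult (a, b) v = 0 \<or> sed_mult v (a, b) = 0"
    by (auto simp: zero_divisors_def)
  then show "orthogonal_pure_pair a b"
    by (cases v) (use annihilating_orthogonal_pure_pairs in blast)
next
  assume ab: "orthogonal_pure_pair a b"
  obtain c where c: "c \<noteq> 0" "c \<in> Im_oct" "\<And>x. x \<in> set [a, b, a \<star> b] \<Longrightarrow> inner c x = 0"
    by (rule exists_common_orthogonal[of "[a, b, a \<star> b]"]) auto
  have "sed_mult (a, b) (c, companion a b c) = 0"
    using companion_annihilates ab c by simp
  moreover have "(c, companion a b c) \<noteq> 0" "(a, b) \<noteq> 0"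
    using c ab by (auto simp: pair_eq_zero_iff orthogonal_pure_pair_def)
  ultimately show "(a, b) \<in> zero_divisors" unfolding zero_divisors_def by blast
qed


section \<open>The product line of a vertex\<close>

lemma span_singleton_eqD:
  fixes x y :: "'a :: real_vector"
  assumes "span {x} = span {y}"
  obtains k where "y = k *\<^sub>R x"
  using assms span_base[of y "{y}"] by (auto simp: span_singleton)

lemma span_singleton_scaleR:
  fixes x :: "'a :: real_vector"
  assumes "k \<noteq> 0"
  shows "span {k *\<^sub>R x} = span {x}"
proof
  show "span {k *\<^sub>R x} \<subseteq> span {x}" by (simp add: span_minimal span_scale span_base)
  have "x = (1 / k) *\<^sub>R (k *\<^sub>R x)" using assms by simp
  then have "x \<in> span {k *\<^sub>R x}" by (metis span_scale span_base singletonI)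
  then show "span {x} \<subseteq> span {k *\<^sub>R x}" by (simp add: span_minimal)
qed

text \<open>
  The product line depends on the vertex only, since rescaling \<open>(a, b)\<close> by \<open>k\<close> multiplies \<open>ab\<close> by
  \<open>k\<^sup>2\<close>; this makes the description below unique.
\<close>

definition product_line :: "sedenion set \<Rightarrow> octonion set" where
  "product_line L = (THE M. \<exists>a b. L = span {(a, b)} \<and> M = span {a \<star> b})"

lemma span_product_cong:
  assumes "span {(a, b)} = span {(c, d) :: sedenion}"
  shows "span {a \<star> b} = span {c \<star> d}"
proof (cases "(c, d) = (0 :: sedenion)")
  case True
  then have "(a, b) = 0" using assms span_base[of "(a, b)" "{(a, b)}"] by auto
  then show ?thesis using True by (auto simp: pair_eq_zero_iff)
next
  case False
  obtain k where k: "(c, d) = k *\<^sub>R (a, b)" using span_singleton_eqD[OF assms] .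
  with False have "k \<noteq> 0" by (auto simp: pair_eq_zero_iff)
  moreover have "c \<star> d = (k * k) *\<^sub>R (a \<star> b)"
    using k by (simp add: oct.scaleR_left oct.scaleR_right)
  ultimately show ?thesis using span_singleton_scaleR[of "k * k" "a \<star> b"] by simp
qed

lemma product_line_span [simp]: "product_line (span {(a, b)}) = span {a \<star> b}"
  unfolding product_line_def by (rule the_equality) (use span_product_cong in blast)+

lemma product_line_adjacent:
  assumes "sed_mult (a, b) (c, d) = 0"
    and ab: "orthogonal_pure_pair a b" and cd: "orthogonal_pure_pair c d"
  shows "span {a \<star> b} = span {c \<star> d}"
proof -
  note d = annihilator_eq_companion[OF assms]
  have c: "c \<in> Im_oct" "c \<noteq> 0" "a \<noteq> 0" using ab cd by (auto simp: orthogonal_pure_pair_def)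
  have "c \<star> d = - ((norm c)\<^sup>2 / (norm a)\<^sup>2) *\<^sub>R (a \<star> b)"
    using mult_companion[OF ab c(1) d(1)] d(2) by simp
  moreover have "- ((norm c)\<^sup>2 / (norm a)\<^sup>2) \<noteq> 0" using c by simp
  ultimately show ?thesis using span_singleton_scaleR by metis
qed

lemma product_line_in_proj:
  assumes "orthogonal_pure_pair a b"
  shows "span {a \<star> b} \<in> proj_Im_oct"
proof -
  have "a \<star> b \<in> Im_oct" using assms Im_mult_orthogonal unfolding orthogonal_pure_pair_def by blast
  then have "span {a \<star> b} \<subseteq> Im_oct" by (simp add: span_minimal subspace_Im_oct)
  moreover have "norm (a \<star> b) \<noteq> 0" using assms by (auto simp: orthogonal_pure_pair_def norm_oct_mult)
  then have "independent {a \<star> b}" by (auto simp: dependent_single)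
  then have "dim (span {a \<star> b}) = 1" using dim_span_eq_card_independent by fastforce
  ultimately show ?thesis by (simp add: proj_Im_oct_def)
qed

text \<open>
  For pure \<open>a\<close> orthogonal to \<open>n\<close> one has \<open>a(an) = - |a|\<^sup>2 n\<close>, so a multiple of \<open>an\<close> serves as the
  second component; the factor \<open>1 / |n|\<close> equalises the norms.
\<close>

lemma exists_pair_with_product_line:
  assumes "L \<in> proj_Im_oct"
  obtains a b where "orthogonal_pure_pair a b" "span {a \<star> b} = L"
proof -
  have L: "subspace L" "L \<subseteq> Im_oct" "dim L = 1" using assms by (auto simp: proj_Im_oct_def)
  obtain B where B: "B \<subseteq> L" "independent B" "L \<subseteq> span B" "card B = 1"
    using basis_exists[of L] L(3) by metis
  then obtain n where n: "B = {n}" by (auto simp: card_1_singleton_iff)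
  have Ln: "L = span {n}" using B n L(1) span_minimal by blast
  have n0: "n \<noteq> 0" using B(2) n by (auto simp: dependent_zero)
  have nI: "n \<in> Im_oct" using B(1) n L(2) by auto
  obtain a where "a \<noteq> 0" "a \<in> Im_oct" "\<And>x. x \<in> set [n] \<Longrightarrow> inner a x = 0"
    by (rule exists_common_orthogonal[of "[n]"]) auto
  then have a: "a \<noteq> 0" "a \<in> Im_oct" "inner a n = 0" by simp_all
  define b where "b = (1 / norm n) *\<^sub>R (a \<star> n)"
  have "a \<star> n \<in> Im_oct" using Im_mult_orthogonal a nI by blast
  then have "b \<in> Im_oct" unfolding b_def using subspace_mul[OF subspace_Im_oct] by blast
  moreover have "inner (a \<star> n) a = 0" using nI by (simp add: inner_mult_left_factor Im_oct_iff)
  then have "inner a b = 0" by (simp add: b_def inner_commute)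
  moreover have "norm a = norm b" using n0 by (simp add: b_def norm_oct_mult)
  ultimately have pair: "orthogonal_pure_pair a b" using a by (simp add: orthogonal_pure_pair_def)
  have "a \<star> b = (- ((norm a)\<^sup>2 / norm n)) *\<^sub>R n"
    by (simp add: b_def oct.scaleR_right Im_mult_cancel_left[OF a(2)])
  moreover have "- ((norm a)\<^sup>2 / norm n) \<noteq> 0" using a n0 by simp
  ultimately have "span {a \<star> b} = L" using span_singleton_scaleR Ln by metis
  with pair show thesis using that by blast
qed


section \<open>Connectedness\<close>

abbreviation \<Gamma> :: "(sedenion set, sedenion set \<times> sedenion set) pre_digraph" where
  "\<Gamma> \<equiv> with_proj orth_graph"

interpretation \<Gamma>: sym_digraph \<Gamma>
  by (rule sym_digraph_orth_graph)

lemma vertexE: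
  assumes "L \<in> verts \<Gamma>"
  obtains a b where "L = span {(a, b)}" "orthogonal_pure_pair a b"
proof -
  obtain u where "L = span {u}" "u \<in> zero_divisors"
    using assms unfolding orth_graph_def with_proj_simps pair_pre_digraph.simps by blast
  then show thesis using that by (cases u) (simp add: zero_divisors_iff)
qed

lemma vertexI: "orthogonal_pure_pair a b \<Longrightarrow> span {(a, b)} \<in> verts \<Gamma>"
  unfolding orth_graph_def with_proj_simps pair_pre_digraph.simps zero_divisors_iff[symmetric]
  by blast

lemma adjacent_product_line:
  assumes "L \<rightarrow>\<^bsub>\<Gamma>\<^esub> M"
  shows "product_line L = product_line M"
proof -
  from assms have "(L, M) \<in> parcs orth_graph" by (simp add: arcs_ends_def arc_to_ends_def)
  then obtain u v where "L = span {u}" "M = span {v}"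
    "u \<in> zero_divisors" "v \<in> zero_divisors" "sed_mult u v = 0"
    unfolding orth_graph_def pair_pre_digraph.simps by blast
  then show ?thesis
    by (cases u; cases v) (simp add: zero_divisors_iff product_line_adjacent)
qed

lemma reachable_product_line:
  assumes "L \<rightarrow>\<^sup>*\<^bsub>\<Gamma>\<^esub> M"
  shows "product_line L = product_line M"
  using assms
proof (induction rule: \<Gamma>.reachable_induct)
  case (step M N)
  then show ?case using adjacent_product_line[of M N] by simp
qed simp

lemma reachable_if_annihilating:
  assumes "sed_mult (a, b) (c, d) = 0" "sed_mult (c, d) (a, b) = 0"
    and "orthogonal_pure_pair a b" "orthogonal_pure_pair c d"
  shows "span {(a, b)} \<rightarrow>\<^sup>*\<^bsub>\<Gamma>\<^esub> span {(c, d)}"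
proof (cases "span {(a, b)} = span {(c, d) :: sedenion}")
  case True
  then show ?thesis using vertexI[OF assms(3)] by simp
next
  case False
  then have "(span {(a, b)}, span {(c, d)}) \<in> parcs orth_graph"
    using assms
    unfolding orth_graph_def pair_pre_digraph.simps zero_divisors_iff[symmetric] by blast
  then have "span {(a, b)} \<rightarrow>\<^bsub>\<Gamma>\<^esub> span {(c, d)}" by (simp add: arcs_ends_def arc_to_ends_def)
  then show ?thesis by (rule \<Gamma>.reachable_adjI)
qed

lemma reachable_companion:
  assumes ab: "orthogonal_pure_pair a b" and c: "c \<noteq> 0" "c \<in> Im_oct"
    and orth: "inner c a = 0" "inner c b = 0" "inner c (a \<star> b) = 0"
  shows "orthogonal_pure_pair c (companion a b c)"
    "span {(a, b)} \<rightarrow>\<^sup>*\<^bsub>\<Gamma>\<^esub> span {(c, companion a b c)}"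
proof -
  note zero = companion_annihilates[OF ab c(2) orth]
  have "(c, companion a b c) \<noteq> 0" "(a, b) \<noteq> 0"
    using c ab by (auto simp: pair_eq_zero_iff orthogonal_pure_pair_def)
  then show pair: "orthogonal_pure_pair c (companion a b c)"
    using annihilating_orthogonal_pure_pairs zero by blast
  show "span {(a, b)} \<rightarrow>\<^sup>*\<^bsub>\<Gamma>\<^esub> span {(c, companion a b c)}"
    using reachable_if_annihilating zero ab pair by blast
qed

text \<open>
  Since \<open>|ab| = |a|\<^sup>2\<close>, the vector \<open>ab / |a|\<^sup>2\<close> is the unit vector in the direction of \<open>ab\<close>, so
  the companion of \<open>c\<close> depends on that direction only.
\<close>

lemma companion_cong:
  assumes ab: "orthogonal_pure_pair a b" and cd: "orthogonal_pure_pair a' b'"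
    and k: "a' \<star> b' = k *\<^sub>R (a \<star> b)" "k > 0"
  shows "companion a' b' c = companion a b c"
proof -
  have "norm (a' \<star> b') = k * norm (a \<star> b)" using k by simp
  then have "(norm a')\<^sup>2 = k * (norm a)\<^sup>2"
    using ab cd by (simp add: orthogonal_pure_pair_def norm_oct_mult power2_eq_square)
  then show ?thesis using k by (simp add: companion_def oct.scaleR_left)
qed

lemma reachable_if_positive_multiple:
  assumes ab: "orthogonal_pure_pair a b" and ab': "orthogonal_pure_pair a' b'"
    and k: "a' \<star> b' = k *\<^sub>R (a \<star> b)" "k > 0"
  shows "span {(a, b)} \<rightarrow>\<^sup>*\<^bsub>\<Gamma>\<^esub> span {(a', b')}"
proof -
  obtain c where c: "c \<noteq> 0" "c \<in> Im_oct"
    "\<And>x. x \<in> set [a, b, a \<star> b, a', b'] \<Longrightarrow> inner c x = 0"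
    by (rule exists_common_orthogonal[of "[a, b, a \<star> b, a', b']"]) auto
  have "span {(a, b)} \<rightarrow>\<^sup>*\<^bsub>\<Gamma>\<^esub> span {(c, companion a b c)}"
    using reachable_companion ab c by simp
  moreover have "span {(a', b')} \<rightarrow>\<^sup>*\<^bsub>\<Gamma>\<^esub> span {(c, companion a' b' c)}"
    using reachable_companion ab' c k by simp
  ultimately show ?thesis
    using companion_cong[OF assms] \<Gamma>.symmetric_reachable' \<Gamma>.reachable_trans by metis
qed

text \<open>
  A single edge turns a negative factor between the products into a positive one.
\<close>

lemma reachable_if_same_line:
  assumes ab: "orthogonal_pure_pair a b" and ab': "orthogonal_pure_pair a' b'"
    and line: "span {a \<star> b} = span {a' \<star> b'}"
  shows "span {(a, b)} \<rightarrow>\<^sup>*\<^bsub>\<Gamma>\<^esub> span {(a', b')}"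
proof -
  obtain k where k: "a' \<star> b' = k *\<^sub>R (a \<star> b)" using span_singleton_eqD[OF line] .
  have "norm (a' \<star> b') \<noteq> 0" using ab' by (auto simp: orthogonal_pure_pair_def norm_oct_mult)
  then consider "k > 0" | "k < 0" using k by fastforce
  then show ?thesis
  proof cases
    case 1
    then show ?thesis using reachable_if_positive_multiple ab ab' k by blast
  next
    case 2
    obtain c where c: "c \<noteq> 0" "c \<in> Im_oct" "\<And>x. x \<in> set [a', b', a' \<star> b'] \<Longrightarrow> inner c x = 0"
      by (rule exists_common_orthogonal[of "[a', b', a' \<star> b']"]) auto
    define d where "d = companion a' b' c"
    have cd: "orthogonal_pure_pair c d" "span {(a', b')} \<rightarrow>\<^sup>*\<^bsub>\<Gamma>\<^esub> span {(c, d)}"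
      using reachable_companion ab' c by (simp_all add: d_def)
    have "inner c (a' \<star> b') = 0" using c(3) by simp
    from mult_companion[OF ab' c(2) this]
    have "c \<star> d = (- ((norm c)\<^sup>2 / (norm a')\<^sup>2) * k) *\<^sub>R (a \<star> b)"
      by (simp add: d_def k)
    moreover have "a' \<noteq> 0" using ab' unfolding orthogonal_pure_pair_def by blast
    then have "(norm c)\<^sup>2 / (norm a')\<^sup>2 > 0" using c(1) by simp
    then have "- ((norm c)\<^sup>2 / (norm a')\<^sup>2) * k > 0" using 2 by (intro mult_neg_neg) simp_all
    ultimately have "span {(a, b)} \<rightarrow>\<^sup>*\<^bsub>\<Gamma>\<^esub> span {(c, d)}"
      using reachable_if_positive_multiple ab cd(1) by blast
    then show ?thesis using cd(2) \<Gamma>.symmetric_reachable' \<Gamma>.reachable_trans by metis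
  qed
qed

lemma reachable_iff_product_line:
  assumes "L \<in> verts \<Gamma>" "M \<in> verts \<Gamma>"
  shows "L \<rightarrow>\<^sup>*\<^bsub>\<Gamma>\<^esub> M \<longleftrightarrow> product_line L = product_line M"
  using assms reachable_product_line
  by (metis vertexE product_line_span reachable_if_same_line)


section \<open>Components and pure lines\<close>

lemma component_verts: "verts ` orth_components = \<Gamma>.scc_of ` verts \<Gamma>"
  unfolding orth_components_def using \<Gamma>.sccs_verts_conv \<Gamma>.sccs_verts_conv_scc_of by simp

lemma scc_of_conv_product_line:
  assumes "L \<in> verts \<Gamma>"
  shows "\<Gamma>.scc_of L = {M \<in> verts \<Gamma>. product_line M = product_line L}"
proof -
  have "L \<rightarrow>\<^sup>*\<^bsub>\<Gamma>\<^esub> M \<and> M \<rightarrow>\<^sup>*\<^bsub>\<Gamma>\<^esub> L \<longleftrightarrow> M \<in> verts \<Gamma> \<and> product_line M = product_line L" for M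
    using reachable_iff_product_line[OF assms] reachable_iff_product_line[OF _ assms]
      \<Gamma>.reachable_in_verts(2) by metis
  then show ?thesis unfolding \<Gamma>.scc_of_def by blast
qed

theorem theorem4p15:
  shows "\<exists>\<psi>. bij_betw \<psi> orth_components proj_Im_oct \<and>
    (\<forall>C\<in>orth_components. \<forall>a b :: octonion.
       span {(a, b)} \<in> verts C \<longrightarrow> \<psi> C = span {oct_mult a b})"
proof -
  \<comment> \<open>All vertices of a component have the same product line, so any representative serves.\<close>
  define \<psi> where "\<psi> C = product_line (SOME L. L \<in> verts C)"
    for C :: "(sedenion set, sedenion set \<times> sedenion set) pre_digraph"
  have component: "\<exists>L \<in> verts \<Gamma>. verts C = {M \<in> verts \<Gamma>. product_line M = product_line L} \<and>
      \<psi> C = product_line L" if "C \<in> orth_components" for C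
  proof -
    have "verts C \<in> \<Gamma>.scc_of ` verts \<Gamma>"
      unfolding component_verts[symmetric] using that by (rule imageI)
    then obtain L where "L \<in> verts \<Gamma>" "verts C = \<Gamma>.scc_of L" by (rule imageE)
    then have L: "L \<in> verts \<Gamma>" "verts C = {M \<in> verts \<Gamma>. product_line M = product_line L}"
      by (simp_all only: scc_of_conv_product_line)
    then have "L \<in> verts C" by blast
    then have "(SOME L. L \<in> verts C) \<in> verts C" by (rule someI)
    then have "\<psi> C = product_line L" using L(2) by (simp add: \<psi>_def)
    then show ?thesis using L by blast
  qed
  have value_eq: "\<psi> C = product_line M" if "C \<in> orth_components" "M \<in> verts C" for C M
    using component[OF that(1)] that(2) by auto
  have "inj_on \<psi> orth_components"
  proof (rule inj_onI)
    fix C D assume C: "C \<in> orth_components" and D: "D \<in> orth_components" and "\<psi> C = \<psi> D"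
    then have "verts C = verts D" using component[OF C] component[OF D] by auto
    then show "C = D"
      using \<Gamma>.inj_on_verts_sccs C D unfolding orth_components_def by (auto dest: inj_onD)
  qed
  moreover have "\<psi> ` orth_components = proj_Im_oct"
  proof (intro equalityI subsetI)
    fix L assume "L \<in> \<psi> ` orth_components"
    then obtain M where M: "M \<in> verts \<Gamma>" "L = product_line M" using component by blast
    from M(1) obtain a b where "M = span {(a, b)}" "orthogonal_pure_pair a b" by (rule vertexE)
    then show "L \<in> proj_Im_oct" using M(2) product_line_in_proj by simp
  next
    fix L assume "L \<in> proj_Im_oct"
    then obtain a b where ab: "orthogonal_pure_pair a b" "span {a \<star> b} = L"
      by (rule exists_pair_with_product_line)
    have "\<Gamma>.scc_of (span {(a, b)}) \<in> verts ` orth_components"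
      unfolding component_verts using vertexI[OF ab(1)] by (rule imageI)
    then obtain C where C: "\<Gamma>.scc_of (span {(a, b)}) = verts C" "C \<in> orth_components"
      by (rule imageE)
    have "span {(a, b)} \<in> verts C"
      using \<Gamma>.in_scc_of_self[OF vertexI[OF ab(1)]] unfolding C(1) .
    then have "\<psi> C = L" using value_eq[OF C(2)] ab(2) by simp
    then show "L \<in> \<psi> ` orth_components" using C(2) by blast
  qed
  ultimately have "bij_betw \<psi> orth_components proj_Im_oct" by (simp add: bij_betw_def)
  moreover have "\<psi> C = span {oct_mult a b}"
    if "C \<in> orth_components" "span {(a, b)} \<in> verts C" for C a b
    using value_eq[OF that] by simp
  ultimately show ?thesis by blast
qed

end
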